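(* Let $J$ be a finite set and let $\psi\colon 2^J\to\mathbb{R}$ be a weakly infinite-alternating set function. Then $\psi$ has a $7$-bounded monotonic sum-decomposition and a $7$-bounded monotonic diff-decomposition.
   Context: For a set function $\varphi\colon 2^J\to\mathbb{R}$, a positive integer $k$ and $A_0,\dots,A_k\subseteq J$, let $V_\varphi(A_0;A_1,\dots,A_k)=\sum_{K\subseteq\{1,\dots,k\}}(-1)^{|K|}\varphi\bigl(A_0\cup\bigcup_{i\in K}A_i\bigr)$. The function $\varphi$ is weakly $k$-alternating if $\varphi(\emptyset)=0$ and $V_\varphi(A_0;A_1,\dots,A_k)\le 0$ for all pairwise disjoint $A_0,A_1,\dots,A_k\subseteq J$. It is weakly infinite-alternating if it is weakly $k$-alternating for every $k\ge 2$. A set function $\varphi$ is increasing (decreasing) if $X\subseteq Y$ implies $\varphi(X)\le\varphi(Y)$ (respectively $\varphi(X)\ge\varphi(Y)$), and submodular if $\varphi(X)+\varphi(Y)\ge\varphi(X\cap Y)+\varphi(X\cup Y)$ for all $X,Y\subseteq J$. Let $\|\varphi\|=\max_{X\subseteq J}|\varphi(X)|$. A monotonic sum-decomposition of $\psi$ is $\psi=\varphi_1+\varphi_2$ with $\varphi_1$ increasing submodular, $\varphi_2$ decreasing submodular and $\varphi_1(\emptyset)=\varphi_2(\emptyset)=0$. A monotonic diff-decomposition of $\psi$ is $\psi=\varphi_1-\varphi_2$ with $\varphi_1,\varphi_2$ both increasing submodular and $\varphi_1(\emptyset)=\varphi_2(\emptyset)=0$. Either decomposition is $c$-bounded if $\|\varphi_i\|\le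 c\cdot\|\psi\|$ for $i=1,2$. *)

theory Defs
  imports Complex_Main "HOL-Library.Disjoint_Sets"
begin

text \<open>
  A set function on \<open>2\<^sup>J\<close> is represented by a total function \<open>'a set \<Rightarrow> real\<close>;
  all notions below depend only on its values on subsets of the ground set \<open>J\<close>.
\<close>

definition alt_diff :: "('a set \<Rightarrow> real) \<Rightarrow> nat \<Rightarrow> (nat \<Rightarrow> 'a set) \<Rightarrow> real" where
  "alt_diff \<phi> k A = (\<Sum>K\<in>Pow {1..k}. (- 1) ^ card K * \<phi> (A 0 \<union> (\<Union>i\<in>K. A i)))"

text \<open>
  Pairwise disjointness is that of the indexed family \<open>A 0, \<dots>, A k\<close> (including \<open>A 0\<close>);
  members may be empty.
\<close>

definition weakly_alternating :: "'a set \<Rightarrow> nat \<Rightarrow> ('a set \<Rightarrow> real) \<Rightarrow> bool" where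
  "weakly_alternating J k \<phi> \<longleftrightarrow>
     \<phi> {} = 0 \<and>
     (\<forall>A. (\<forall>i\<in>{0..k}. A i \<subseteq> J) \<and> disjoint_family_on A {0..k} \<longrightarrow> alt_diff \<phi> k A \<le> 0)"

definition weakly_infinite_alternating :: "'a set \<Rightarrow> ('a set \<Rightarrow> real) \<Rightarrow> bool" where
  "weakly_infinite_alternating J \<phi> \<longleftrightarrow> (\<forall>k\<ge>2. weakly_alternating J k \<phi>)"

definition increasing_setfun :: "'a set \<Rightarrow> ('a set \<Rightarrow> real) \<Rightarrow> bool" where
  "increasing_setfun J \<phi> \<longleftrightarrow> mono_on (Pow J) \<phi>"

definition decreasing_setfun :: "'a set \<Rightarrow> ('a set \<Rightarrow> real) \<Rightarrow> bool" where
  "decreasing_setfun J \<phi> \<longleftrightarrow> antimono_on (Pow J) \<phi>"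

definition submodular :: "'a set \<Rightarrow> ('a set \<Rightarrow> real) \<Rightarrow> bool" where
  "submodular J \<phi> \<longleftrightarrow>
     (\<forall>X Y. X \<subseteq> J \<and> Y \<subseteq> J \<longrightarrow> \<phi> X + \<phi> Y \<ge> \<phi> (X \<inter> Y) + \<phi> (X \<union> Y))"

text \<open>Meaningful for finite \<open>J\<close> only, as \<open>Max\<close> is unspecified on infinite sets.\<close>

definition setfun_norm :: "'a set \<Rightarrow> ('a set \<Rightarrow> real) \<Rightarrow> real" where
  "setfun_norm J \<phi> = Max ((\<lambda>X. \<bar>\<phi> X\<bar>) ` Pow J)"

definition monotonic_sum_decomposition ::
  "'a set \<Rightarrow> ('a set \<Rightarrow> real) \<Rightarrow> ('a set \<Rightarrow> real) \<Rightarrow> ('a set \<Rightarrow> real) \<Rightarrow> bool" where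
  "monotonic_sum_decomposition J \<psi> \<phi>1 \<phi>2 \<longleftrightarrow>
     (\<forall>X\<subseteq>J. \<psi> X = \<phi>1 X + \<phi>2 X) \<and>
     increasing_setfun J \<phi>1 \<and> submodular J \<phi>1 \<and>
     decreasing_setfun J \<phi>2 \<and> submodular J \<phi>2 \<and>
     \<phi>1 {} = 0 \<and> \<phi>2 {} = 0"

definition monotonic_diff_decomposition ::
  "'a set \<Rightarrow> ('a set \<Rightarrow> real) \<Rightarrow> ('a set \<Rightarrow> real) \<Rightarrow> ('a set \<Rightarrow> real) \<Rightarrow> bool" where
  "monotonic_diff_decomposition J \<psi> \<phi>1 \<phi>2 \<longleftrightarrow>
     (\<forall>X\<subseteq>J. \<psi> X = \<phi>1 X - \<phi>2 X) \<and>
     increasing_setfun J \<phi>1 \<and> submodular J \<phi>1 \<and>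
     increasing_setfun J \<phi>2 \<and> submodular J \<phi>2 \<and>
     \<phi>1 {} = 0 \<and> \<phi>2 {} = 0"

definition bounded_decomposition ::
  "'a set \<Rightarrow> real \<Rightarrow> ('a set \<Rightarrow> real) \<Rightarrow> ('a set \<Rightarrow> real) \<Rightarrow> ('a set \<Rightarrow> real) \<Rightarrow> bool" where
  "bounded_decomposition J c \<psi> \<phi>1 \<phi>2 \<longleftrightarrow>
     setfun_norm J \<phi>1 \<le> c * setfun_norm J \<psi> \<and> setfun_norm J \<phi>2 \<le> c * setfun_norm J \<psi>"

end

theory Submission
  imports Defs
begin

text \<open>
  Coverage functions \<open>X \<mapsto> of_bool (S \<inter> X \<noteq> {})\<close> with \<open>S\<close> nonempty form a basis of the set functions that
  vanish at \<open>{}\<close>. Applied to singletons \<open>A\<^sub>1, \<dots>, A\<^sub>k\<close> that enumerate \<open>S\<close> and to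
  \<open>A\<^sub>0 = J - S\<close>, the alternating difference \<open>V\<close> of \<open>\<psi>\<close> is minus the coefficient of \<open>S\<close>. A weakly
  infinite-alternating \<open>\<psi>\<close> is therefore a nonnegative combination of the coverage functions with
  \<open>card S \<ge> 2\<close> plus a modular function. The coefficient of the singleton \<open>{j}\<close> is the last marginal
  \<open>\<psi> J - \<psi> (J - {j})\<close>, of arbitrary sign. Let \<open>N\<close> be the set of those \<open>j\<close> where it is negative,
  let \<open>m\<close> be the modular function whose weights are the negative parts of the last marginals, and
  put \<open>\<phi> = \<psi> + m\<close>. By submodularity the last marginal of an element is its smallest one, so \<open>\<phi>\<close> is
  increasing. Hence \<open>\<psi> = \<phi> + (- m) = \<phi> - m\<close> gives both decompositions, and since \<open>\<phi>\<close> and \<open>m\<close> are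
  increasing, only \<open>\<phi> J\<close> and \<open>m J\<close> remain to be bounded.

  For this the average of \<open>\<psi> (J - Y)\<close> over all \<open>Y \<subseteq> N\<close> is compared with \<open>M = \<parallel>\<psi>\<parallel>\<close>. A set \<open>S \<subseteq> N\<close> is missed
  by \<open>J - Y\<close> with probability \<open>1 / 2 ^ card S\<close>, which is \<open>1/2\<close> for singletons but at most \<open>1/4\<close> for
  larger sets. The singletons have negative coefficients and the larger sets nonnegative ones: if
  both were large and cancelled in \<open>\<psi> J\<close>, the average would be large. Quantitatively,
  \<open>m J \<le> 4 * M - 3 * \<psi> J - \<psi> (J - N)\<close> (\<open>negative_marginals_bound\<close>). Here
  \<open>\<psi> (J - N) = \<phi> (J - N) \<ge> 0\<close>, so that \<open>m J \<le> 7 * M\<close> and \<open>\<phi> J = \<psi> J + m J \<le> 6 * M\<close>.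
\<close>

section \<open>Coverage coefficients\<close>

text \<open>
  This is the Moebius inverse of \<open>Y \<mapsto> \<psi> (J - Y)\<close>. For nonempty \<open>S\<close> it is minus the coefficient of
  \<open>S\<close> in the coverage expansion of \<open>\<psi>\<close>; working with complements replaces ``\<open>S\<close> meets \<open>X\<close>'' by
  ``\<open>S\<close> is contained in \<open>Y\<close>'', which is the form that Moebius inversion needs.
\<close>

definition mobius_coeff :: "'a set \<Rightarrow> ('a set \<Rightarrow> real) \<Rightarrow> 'a set \<Rightarrow> real" where
  "mobius_coeff J \<psi> S = (- 1) ^ card S * (\<Sum>T\<in>Pow S. (- 1) ^ card T * \<psi> (J - T))"

lemma mobius_coeff_empty: "mobius_coeff J \<psi> {} = \<psi> J"
  by (simp add: mobius_coeff_def)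

lemma mobius_coeff_singleton: "mobius_coeff J \<psi> {j} = \<psi> (J - {j}) - \<psi> J"
  by (simp add: mobius_coeff_def Pow_insert)

lemma setfun_eq_sum_mobius_coeff:
  assumes "finite Y"
  shows "\<psi> (J - Y) = (\<Sum>S\<in>Pow Y. mobius_coeff J \<psi> S)"
  unfolding mobius_coeff_def
  by (rule inclusion_exclusion_symmetric) (simp_all add: assms)

text \<open>
  The subsets of \<open>S\<close> that are removed from \<open>J\<close> in the coefficient are the complements in \<open>S\<close> of the sets
  that are added to \<open>A 0 = J - S\<close> in the alternating difference; the two sign conventions agree because
  the cardinalities of a subset and its complement add up to \<open>card S\<close>.
\<close>

lemma alt_diff_singletons:
  assumes b: "bij_betw b {1..k} S" and "S \<subseteq> J"
  shows "alt_diff \<psi> k (\<lambda>i. if i = 0 then J - S else {b i}) = mobius_coeff J \<psi> S"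
proof -
  have finS: "finite S"
    using b bij_betw_finite by blast
  have bij: "bij_betw (\<lambda>K. S - b ` K) (Pow {1..k}) (Pow S)"
  proof -
    have "bij_betw ((-) S) (Pow S) (Pow S)"
      by (rule bij_betw_byWitness[where f' = "(-) S"]) auto
    with bij_betw_Pow[OF b] show ?thesis
      by (auto dest: bij_betw_trans simp: comp_def)
  qed
  have "mobius_coeff J \<psi> S = (\<Sum>T\<in>Pow S. (- 1) ^ card S * ((- 1) ^ card T * \<psi> (J - T)))"
    by (simp add: mobius_coeff_def sum_distrib_left)
  also have "\<dots> = (\<Sum>K\<in>Pow {1..k}. (- 1) ^ card S * ((- 1) ^ card (S - b ` K) * \<psi> (J - (S - b ` K))))"
    by (rule sum.reindex_bij_betw[OF bij, symmetric])
  also have "\<dots> = alt_diff \<psi> k (\<lambda>i. if i = 0 then J - S else {b i})"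
    unfolding alt_diff_def
  proof (rule sum.cong)
    fix K assume K: "K \<in> Pow {1..k}"
    then have sub: "b ` K \<subseteq> S"
      using b by (auto simp: bij_betw_def)
    have "card (b ` K) = card K"
      using K b by (metis PowD bij_betw_def card_image inj_on_subset)
    then have "card S = card (S - b ` K) + card K"
      using sub finS by (metis card_Diff_subset card_mono finite_subset le_add_diff_inverse2)
    then have sgn: "(- 1 :: real) ^ card S * (- 1) ^ card (S - b ` K) = (- 1) ^ card K"
      by (simp add: power_add flip: power_mult_distrib)
    have "(\<Union>i\<in>K. if i = 0 then J - S else {b i}) = b ` K"
    proof -
      have "(\<Union>i\<in>K. if i = 0 then J - S else {b i}) = (\<Union>i\<in>K. {b i})"
        using K by (intro SUP_cong) auto
      then show ?thesis
        by auto
    qed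
    moreover have "J - (S - b ` K) = (J - S) \<union> b ` K"
      using sub \<open>S \<subseteq> J\<close> by auto
    ultimately show "(- 1) ^ card S * ((- 1) ^ card (S - b ` K) * \<psi> (J - (S - b ` K))) =
      (- 1) ^ card K * \<psi> ((if 0 = (0::nat) then J - S else {b 0}) \<union> (\<Union>i\<in>K. if i = 0 then J - S else {b i}))"
      by (simp add: sgn flip: mult.assoc)
  qed simp
  finally show ?thesis ..
qed

lemma weakly_alternatingD:
  assumes "weakly_alternating J k \<phi>"
    and "\<And>i. i \<in> {0..k} \<Longrightarrow> A i \<subseteq> J" and "disjoint_family_on A {0..k}"
  shows "alt_diff \<phi> k A \<le> 0"
  using assms by (auto simp: weakly_alternating_def)

lemma mobius_coeff_nonpos:
  assumes alt: "weakly_infinite_alternating J \<psi>" and "finite S" "S \<subseteq> J" "card S \<ge> 2"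
  shows "mobius_coeff J \<psi> S \<le> 0"
proof -
  obtain b where b: "bij_betw b {1..card S} S"
    using ex_bij_betw_nat_finite_1[OF \<open>finite S\<close>] by blast
  let ?A = "\<lambda>i. if i = 0 then J - S else {b i}"
  have bS: "b i \<in> S" if "i \<in> {1..card S}" for i
    using b that by (auto simp: bij_betw_def)
  have "disjoint_family_on ?A {0..card S}"
    unfolding disjoint_family_on_def
  proof (intro ballI impI)
    fix m n assume mn: "m \<in> {0..card S}" "n \<in> {0..card S}" "m \<noteq> n"
    then have "b m \<noteq> b n" if "m \<noteq> 0" "n \<noteq> 0"
      using bij_betw_imp_inj_on[OF b] that by (simp add: inj_on_eq_iff)
    then show "?A m \<inter> ?A n = {}"
      using bS[of m] bS[of n] mn by auto
  qed
  moreover have "?A i \<subseteq> J" if "i \<in> {0..card S}" for i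
    using bS[of i] that \<open>S \<subseteq> J\<close> by auto
  moreover have "weakly_alternating J (card S) \<psi>"
    using alt \<open>card S \<ge> 2\<close> by (simp add: weakly_infinite_alternating_def)
  ultimately have "alt_diff \<psi> (card S) ?A \<le> 0"
    by (intro weakly_alternatingD)
  then show ?thesis
    using alt_diff_singletons[OF b \<open>S \<subseteq> J\<close>] by simp
qed

section \<open>Submodularity and monotonicity\<close>

text \<open>
  Two arbitrary sets \<open>X\<close>, \<open>Y\<close> split into the three disjoint pieces \<open>X \<inter> Y\<close>, \<open>X - Y\<close>, \<open>Y - X\<close>, so
  disjoint families already see the full submodular inequality.
\<close>

lemma weakly_alternating_2_imp_submodular:
  assumes "weakly_alternating J 2 \<psi>"
  shows "submodular J \<psi>"
  unfolding submodular_def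
proof (intro allI impI)
  fix X Y assume XY: "X \<subseteq> J \<and> Y \<subseteq> J"
  let ?A = "\<lambda>i::nat. if i = 0 then X \<inter> Y else if i = 1 then X - Y else Y - X"
  have "disjoint_family_on ?A {0..2}"
    by (auto simp: disjoint_family_on_def split: if_splits)
  moreover have "?A i \<subseteq> J" if "i \<in> {0..2}" for i
    using XY by auto
  ultimately have "alt_diff \<psi> 2 ?A \<le> 0"
    by (intro weakly_alternatingD[OF assms])
  moreover have "alt_diff \<psi> 2 ?A = \<psi> (X \<inter> Y) - \<psi> X - \<psi> Y + \<psi> (X \<union> Y)"
  proof -
    have two: "{1..2} = {1, 2::nat}"
      by auto
    have "X \<inter> Y \<union> (X - Y) = X" "X \<inter> Y \<union> (Y - X) = Y"
        "X \<inter> Y \<union> ((X - Y) \<union> (Y - X)) = X \<union> Y" "X \<inter> Y \<union> ((Y - X) \<union> (X - Y)) = X \<union> Y"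
      by auto
    then show ?thesis
      unfolding alt_diff_def two by (simp add: Pow_insert)
  qed
  ultimately show "\<psi> X + \<psi> Y \<ge> \<psi> (X \<inter> Y) + \<psi> (X \<union> Y)"
    by linarith
qed

lemma submodular_add_modular:
  fixes w :: "'a \<Rightarrow> real"
  assumes "finite J" "submodular J \<psi>"
  shows "submodular J (\<lambda>X. \<psi> X + sum w X)"
  unfolding submodular_def
proof (intro allI impI)
  fix X Y assume XY: "X \<subseteq> J \<and> Y \<subseteq> J"
  then have "sum w (X \<union> Y) + sum w (X \<inter> Y) = sum w X + sum w Y"
    using assms(1) by (intro sum.union_inter) (auto intro: finite_subset)
  moreover have "\<psi> X + \<psi> Y \<ge> \<psi> (X \<inter> Y) + \<psi> (X \<union> Y)"
    using assms(2) XY by (auto simp: submodular_def)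
  ultimately show "\<psi> X + sum w X + (\<psi> Y + sum w Y) \<ge>
      \<psi> (X \<inter> Y) + sum w (X \<inter> Y) + (\<psi> (X \<union> Y) + sum w (X \<union> Y))"
    by linarith
qed

text \<open>
  Marginals of a submodular function decrease as the set grows, so the marginal of \<open>j\<close> at \<open>J - {j}\<close> is
  its smallest one; weights that compensate these compensate all marginals.
\<close>

lemma submodular_add_modular_increasing:
  fixes w :: "'a \<Rightarrow> real"
  assumes "finite J" and sub: "submodular J \<psi>"
    and w: "\<And>j. j \<in> J \<Longrightarrow> w j \<ge> \<psi> (J - {j}) - \<psi> J"
  shows "increasing_setfun J (\<lambda>X. \<psi> X + sum w X)"
  unfolding increasing_setfun_def
proof (rule mono_onI)
  fix X Y assume XY: "X \<in> Pow J" "Y \<in> Pow J" "X \<le> Y"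
  have "\<psi> X + sum w X \<le> \<psi> (X \<union> D) + sum w (X \<union> D)" if "finite D" "D \<subseteq> J - X" for D
    using that
  proof (induction D rule: finite_induct)
    case (insert j D)
    let ?Z = "X \<union> D"
    have Z: "?Z \<subseteq> J" "j \<in> J" "j \<notin> ?Z" "finite ?Z"
      using insert XY \<open>finite J\<close> by (auto intro: finite_subset)
    have "insert j ?Z \<inter> (J - {j}) = ?Z" "insert j ?Z \<union> (J - {j}) = J"
      using Z by auto
    then have "\<psi> (insert j ?Z) + \<psi> (J - {j}) \<ge> \<psi> ?Z + \<psi> J"
      using sub[unfolded submodular_def, rule_format, of "insert j ?Z" "J - {j}"] Z by simp
    moreover have "sum w (insert j ?Z) = w j + sum w ?Z"
      using Z by simp
    ultimately have "\<psi> ?Z + sum w ?Z \<le> \<psi> (insert j ?Z) + sum w (insert j ?Z)"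
      using w[OF Z(2)] by linarith
    with insert show ?case
      by force
  qed simp
  from this[of "Y - X"] show "\<psi> X + sum w X \<le> \<psi> Y + sum w Y"
    using XY \<open>finite J\<close> by (auto simp: Un_absorb1 intro: finite_subset)
qed

section \<open>Averaging over the subsets of a set\<close>

text \<open>A fixed \<open>S \<subseteq> N\<close> lies in a uniformly random subset of \<open>N\<close> with probability \<open>1 / 2 ^ card S\<close>.\<close>

lemma sum_Pow_sum_Pow:
  fixes d :: "'a set \<Rightarrow> real"
  assumes "finite N"
  shows "(\<Sum>Y\<in>Pow N. \<Sum>S\<in>Pow Y. d S) = 2 ^ card N * (\<Sum>S\<in>Pow N. d S / 2 ^ card S)"
proof -
  have card: "card {Y \<in> Pow N. S \<subseteq> Y} = 2 ^ (card N - card S)" if "S \<subseteq> N" for S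
  proof -
    have "bij_betw (\<lambda>Z. S \<union> Z) (Pow (N - S)) {Y \<in> Pow N. S \<subseteq> Y}"
      using that by (intro bij_betw_byWitness[where f' = "\<lambda>Y. Y - S"]) auto
    then have "card {Y \<in> Pow N. S \<subseteq> Y} = card (Pow (N - S))"
      by (metis bij_betw_same_card)
    then show ?thesis
      using that assms by (simp add: card_Pow card_Diff_subset finite_subset)
  qed
  have "(\<Sum>Y\<in>Pow N. \<Sum>S\<in>Pow Y. d S) = (\<Sum>Y\<in>Pow N. \<Sum>S\<in>{S \<in> Pow N. S \<subseteq> Y}. d S)"
    by (intro sum.cong) auto
  also have "\<dots> = (\<Sum>S\<in>Pow N. \<Sum>Y\<in>{Y \<in> Pow N. S \<subseteq> Y}. d S)"
    using assms by (intro sum.swap_restrict) auto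
  also have "\<dots> = (\<Sum>S\<in>Pow N. 2 ^ card N * (d S / 2 ^ card S))"
  proof (rule sum.cong)
    fix S assume "S \<in> Pow N"
    then have "S \<subseteq> N" "card S \<le> card N"
      using assms by (auto intro: card_mono)
    then show "(\<Sum>Y\<in>{Y \<in> Pow N. S \<subseteq> Y}. d S) = 2 ^ card N * (d S / 2 ^ card S)"
      by (simp only: sum_constant card) (simp add: power_diff[of "2::real"])
  qed simp
  finally show ?thesis
    by (simp add: sum_distrib_left)
qed

text \<open>
  The right-hand side gives weight \<open>1\<close> to the empty set, \<open>1/2\<close> to singletons and \<open>1/4\<close> to all larger
  sets. It is exact up to \<open>card S = 2\<close>, and for larger sets \<open>1/4\<close> only makes a nonpositive term smaller.
  The point is that all sets beyond the singletons enter through the total sum alone.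
\<close>

lemma half_weighted_sum_Pow_ge:
  fixes d :: "'a set \<Rightarrow> real"
  assumes "finite N"
    and neg: "\<And>S. S \<subseteq> N \<Longrightarrow> card S \<ge> 2 \<Longrightarrow> d S \<le> 0"
  shows "(\<Sum>S\<in>Pow N. d S / 2 ^ card S) \<ge>
    (3 * d {} + (\<Sum>j\<in>N. d {j}) + (\<Sum>S\<in>Pow N. d S)) / 4"
proof -
  have singletons: "(\<Sum>S\<in>Pow N. if card S = 1 then d S else 0) = (\<Sum>j\<in>N. d {j})"
  proof -
    have "(\<Sum>S\<in>Pow N. if card S = 1 then d S else 0) = (\<Sum>S\<in>(\<lambda>j. {j}) ` N. d S)"
      using assms(1) by (intro sum.mono_neutral_cong_right) (auto simp: card_1_singleton_iff image_iff)
    also have "\<dots> = (\<Sum>j\<in>N. d {j})"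
      by (subst sum.reindex) auto
    finally show ?thesis .
  qed
  have empty: "(\<Sum>S\<in>Pow N. if S = {} then d S else 0) = d {}"
    using assms(1) by (simp add: sum.delta)
  have "(3 * d {} + (\<Sum>j\<in>N. d {j}) + (\<Sum>S\<in>Pow N. d S)) / 4 =
     (\<Sum>S\<in>Pow N. (3 * (if S = {} then d S else 0) + (if card S = 1 then d S else 0) + d S) / 4)"
    by (simp only: sum_divide_distrib[symmetric] sum.distrib sum_distrib_left[symmetric] singletons empty)
  also have "\<dots> \<le> (\<Sum>S\<in>Pow N. d S / 2 ^ card S)"
  proof (rule sum_mono)
    fix S assume "S \<in> Pow N"
    then have S: "S \<subseteq> N" "finite S"
      using assms(1) by (auto intro: finite_subset)
    consider "S = {}" | "card S = 1" | "card S \<ge> 2"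
      using S by (metis One_nat_def Suc_1 card_eq_0_iff less_2_cases not_le)
    then show "(3 * (if S = {} then d S else 0) + (if card S = 1 then d S else 0) + d S) / 4
        \<le> d S / 2 ^ card S"
    proof cases
      case 3
      have "(2::real) ^ 2 \<le> 2 ^ card S"
        using 3 by (intro power_increasing) auto
      then have "d S / 4 \<le> d S / 2 ^ card S"
        using neg[OF S(1) 3] by (intro divide_left_mono_neg) auto
      moreover have "S \<noteq> {}" "card S \<noteq> 1"
        using 3 by auto
      ultimately show ?thesis
        by simp
    qed auto
  qed
  finally show ?thesis .
qed

text \<open>
  The average of \<open>\<psi> (J - Y)\<close> over \<open>Y \<subseteq> N\<close> is at most \<open>M\<close>. In the lower bound for this average the
  sum over all of \<open>Pow N\<close> is \<open>\<psi> (J - N)\<close> by Moebius inversion, so the bound only involves \<open>\<psi> J\<close>, \<open>\<psi> (J - N)\<close> and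
  the last marginals. It is applied to the elements whose last marginals are negative, where
  every summand is positive.
\<close>

lemma negative_marginals_bound:
  assumes "finite J" and alt: "weakly_infinite_alternating J \<psi>" and "N \<subseteq> J"
    and bound: "\<And>X. X \<subseteq> J \<Longrightarrow> \<psi> X \<le> M"
  shows "(\<Sum>j\<in>N. \<psi> (J - {j}) - \<psi> J) \<le> 4 * M - 3 * \<psi> J - \<psi> (J - N)"
proof -
  let ?d = "mobius_coeff J \<psi>"
  have finN: "finite N"
    using assms finite_subset by blast
  have "2 ^ card N * (\<Sum>S\<in>Pow N. ?d S / 2 ^ card S) = (\<Sum>Y\<in>Pow N. \<psi> (J - Y))"
    by (auto simp: sum_Pow_sum_Pow[OF finN, symmetric] setfun_eq_sum_mobius_coeff
          finite_subset[OF _ finN] intro!: sum.cong)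
  also have "\<dots> \<le> 2 ^ card N * M"
    using sum_bounded_above[of "Pow N" "\<lambda>Y. \<psi> (J - Y)" M] finN bound
    by (auto simp: card_Pow)
  finally have "(\<Sum>S\<in>Pow N. ?d S / 2 ^ card S) \<le> M"
    by simp
  moreover have "(\<Sum>S\<in>Pow N. ?d S / 2 ^ card S) \<ge>
      (3 * ?d {} + (\<Sum>j\<in>N. ?d {j}) + (\<Sum>S\<in>Pow N. ?d S)) / 4"
    using \<open>N \<subseteq> J\<close> by (intro half_weighted_sum_Pow_ge finN mobius_coeff_nonpos[OF alt])
      (auto intro: finite_subset[OF _ finN])
  ultimately have "(3 * ?d {} + (\<Sum>j\<in>N. ?d {j}) + (\<Sum>S\<in>Pow N. ?d S)) / 4 \<le> M"
    by (rule order_trans[rotated])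
  then show ?thesis
    by (simp add: mobius_coeff_empty mobius_coeff_singleton
          setfun_eq_sum_mobius_coeff[OF finN, symmetric])
qed

section \<open>Norm bounds and the decompositions\<close>

lemma abs_le_setfun_norm:
  assumes "finite J" "X \<subseteq> J"
  shows "\<bar>\<phi> X\<bar> \<le> setfun_norm J \<phi>"
  unfolding setfun_norm_def using assms by (intro Max_ge) auto

lemma setfun_norm_le:
  assumes "finite J" "\<And>X. X \<subseteq> J \<Longrightarrow> \<bar>\<phi> X\<bar> \<le> c"
  shows "setfun_norm J \<phi> \<le> c"
  unfolding setfun_norm_def using assms by (subst Max_le_iff) auto

lemma setfun_norm_increasing_le:
  assumes "finite J" "increasing_setfun J \<phi>" "\<phi> {} = 0"
  shows "setfun_norm J \<phi> \<le> \<phi> J"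
proof (rule setfun_norm_le[OF \<open>finite J\<close>])
  fix X assume "X \<subseteq> J"
  then have "\<phi> {} \<le> \<phi> X" "\<phi> X \<le> \<phi> J"
    using assms(2) by (auto simp: increasing_setfun_def monotone_on_def)
  then show "\<bar>\<phi> X\<bar> \<le> \<phi> J"
    using assms(3) by simp
qed

theorem theorem6p2:
  fixes J :: "'a set" and \<psi> :: "'a set \<Rightarrow> real"
  assumes "finite J"
    and "weakly_infinite_alternating J \<psi>"
  shows "(\<exists>\<phi>1 \<phi>2. monotonic_sum_decomposition J \<psi> \<phi>1 \<phi>2 \<and> bounded_decomposition J 7 \<psi> \<phi>1 \<phi>2) \<and>
         (\<exists>\<phi>1 \<phi>2. monotonic_diff_decomposition J \<psi> \<phi>1 \<phi>2 \<and> bounded_decomposition J 7 \<psi> \<phi>1 \<phi>2)"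
proof -
  define w where "w j = max 0 (\<psi> (J - {j}) - \<psi> J)" for j
  define \<phi> where "\<phi> X = \<psi> X + sum w X" for X
  define N where "N = {j \<in> J. \<psi> (J - {j}) > \<psi> J}"
  let ?M = "setfun_norm J \<psi>"
  have "weakly_alternating J 2 \<psi>"
    using assms(2) by (simp add: weakly_infinite_alternating_def)
  then have sub: "submodular J \<psi>" and "\<psi> {} = 0"
    by (auto simp: weakly_alternating_2_imp_submodular weakly_alternating_def)
  then have \<phi>: "\<phi> {} = 0" "submodular J \<phi>" "increasing_setfun J \<phi>"
    unfolding \<phi>_def using submodular_add_modular[OF assms(1) sub]
      submodular_add_modular_increasing[OF assms(1) sub] by (auto simp: w_def)
  have zero: "submodular J (\<lambda>_. 0)"
    by (simp add: submodular_def)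
  have sw: "submodular J (sum w)" "submodular J (\<lambda>X. - sum w X)"
    using submodular_add_modular[OF assms(1) zero, of w]
      submodular_add_modular[OF assms(1) zero, of "\<lambda>j. - w j"] by (simp_all add: sum_negf)
  have mono_w: "sum w X \<le> sum w Y" if "X \<subseteq> Y" "Y \<subseteq> J" for X Y
    using that assms(1) by (intro sum_mono2) (auto simp: w_def intro: finite_subset)
  then have incw: "increasing_setfun J (sum w)" and decw: "decreasing_setfun J (\<lambda>X. - sum w X)"
    by (auto simp: increasing_setfun_def decreasing_setfun_def monotone_on_def)

  \<comment> \<open>No element outside \<open>N\<close> carries weight, so \<open>\<phi>\<close> and \<open>\<psi>\<close> agree on \<open>J - N\<close>.\<close>
  have nonneg: "\<psi> (J - N) \<ge> 0"
  proof -
    have "\<phi> (J - N) \<ge> \<phi> {}"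
      using \<phi>(3) by (auto simp: increasing_setfun_def monotone_on_def)
    moreover have "sum w (J - N) = 0"
      by (intro sum.neutral) (auto simp: w_def N_def)
    ultimately show ?thesis
      using \<phi>(1) by (simp add: \<phi>_def)
  qed
  have "sum w J = (\<Sum>j\<in>N. \<psi> (J - {j}) - \<psi> J)"
    using assms(1) by (intro sum.mono_neutral_cong_right) (auto simp: w_def N_def)
  also have "\<dots> \<le> 4 * ?M - 3 * \<psi> J - \<psi> (J - N)"
    using abs_le_setfun_norm[OF assms(1), of _ \<psi>]
    by (intro negative_marginals_bound assms) (auto simp: N_def abs_le_iff)
  also have "\<dots> \<le> 4 * ?M - 3 * \<psi> J"
    using nonneg by simp
  finally have "sum w J \<le> 4 * ?M - 3 * \<psi> J" .
  moreover have "\<bar>\<psi> J\<bar> \<le> ?M"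
    by (simp add: abs_le_setfun_norm assms(1))
  ultimately have "sum w J \<le> 7 * ?M" "\<phi> J \<le> 7 * ?M"
    by (auto simp: \<phi>_def)
  then have norms: "setfun_norm J (sum w) \<le> 7 * ?M" "setfun_norm J \<phi> \<le> 7 * ?M"
    using setfun_norm_increasing_le[OF assms(1) incw] setfun_norm_increasing_le[OF assms(1) \<phi>(3,1)]
    by auto
  have "setfun_norm J (\<lambda>X. - sum w X) = setfun_norm J (sum w)"
    by (simp add: setfun_norm_def)
  with norms have "bounded_decomposition J 7 \<psi> \<phi> (\<lambda>X. - sum w X)"
      "bounded_decomposition J 7 \<psi> \<phi> (sum w)"
    by (simp_all add: bounded_decomposition_def)
  moreover have "monotonic_sum_decomposition J \<psi> \<phi> (\<lambda>X. - sum w X)"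
    using \<phi> sw decw by (simp add: monotonic_sum_decomposition_def) (simp add: \<phi>_def)
  moreover have "monotonic_diff_decomposition J \<psi> \<phi> (sum w)"
    using \<phi> sw incw by (simp add: monotonic_diff_decomposition_def) (simp add: \<phi>_def)
  ultimately show ?thesis
    by blast
qed

end
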